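(* Let $m$ be a positive integer, $q=2^m$, and $\gamma\in\mathbb{F}_q$. Then the compositional inverse of the permutation polynomial $f_1(x)=x+\gamma\operatorname{Tr}_{q}^{q^2}(x^3+x^{q+2})$ over $\mathbb{F}_{q^2}$ is $x+\gamma(\operatorname{Tr}_{q}^{q^2}(x))^3$.
   Context: $\mathbb{F}_{q^2}$ is the finite field with $q^2$ elements and $\mathbb{F}_q$ its subfield with $q$ elements. $\operatorname{Tr}_q^{q^2}(z)=z+z^q$ for $z\in\mathbb{F}_{q^2}$. A polynomial $f\in\mathbb{F}_{q^2}[x]$ is a permutation polynomial over $\mathbb{F}_{q^2}$ if the map $a\mapsto f(a)$ is a bijection of $\mathbb{F}_{q^2}$. Its compositional inverse is the polynomial $g$ (polynomials being identified with the maps $\mathbb{F}_{q^2}\to\mathbb{F}_{q^2}$ they induce) such that $f(g(x))=g(f(x))=x$ for every $x\in\mathbb{F}_{q^2}$. *)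

theory Defs
  imports "HOL-Computational_Algebra.Polynomial"
begin

definition is_subfield :: "'a::field set \<Rightarrow> bool" where
  "is_subfield K \<longleftrightarrow>
     0 \<in> K \<and> 1 \<in> K \<and>
     (\<forall>a\<in>K. \<forall>b\<in>K. a + b \<in> K \<and> a * b \<in> K) \<and>
     (\<forall>a\<in>K. - a \<in> K \<and> inverse a \<in> K)"

(* The relative trace from the field with q^2 elements to the one with q elements.
   The type is general so that it also applies to polynomials over the larger field;
   by poly_rel_trace this agrees with taking the trace of the values. *)
definition rel_trace :: "nat \<Rightarrow> 'a::comm_ring_1 \<Rightarrow> 'a" where
  "rel_trace q z = z + z ^ q"

lemma poly_rel_trace: "poly (rel_trace q p) x = rel_trace q (poly p x)"
  by (simp add: rel_trace_def poly_power)

definition permutation_poly :: "'a::{field, finite} poly \<Rightarrow> bool" where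
  "permutation_poly f \<longleftrightarrow> bij (poly f)"

(* Over a finite field, a compositional inverse is unique only as the map it induces. *)
definition compositional_inverse :: "'a::{field, finite} poly \<Rightarrow> 'a poly \<Rightarrow> bool" where
  "compositional_inverse f g \<longleftrightarrow>
     (\<forall>x. poly f (poly g x) = x \<and> poly g (poly f x) = x)"

end

theory Submission
  imports Defs "HOL-Computational_Algebra.Primes"
begin

text \<open>
  Write \<open>y = x ^ q\<close>, so that \<open>Tr x = x + y\<close> and, by Lagrange in the multiplicative group of the
  big field, \<open>y ^ q = x\<close>. Since \<open>q\<close> is a power of the characteristic 2, raising to the power \<open>q\<close>
  is additive, and \<open>Tr (x ^ 3 + x ^ (q + 2))\<close> expands to
  \<open>x ^ 3 + x\<^sup>2 * y + x * y\<^sup>2 + y ^ 3\<close>. In characteristic 2 this is \<open>(x + y) ^ 3\<close>, because the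
  binomial coefficient 3 equals 1 (lemma \<open>rel_trace_cube_plus\<close>). So \<open>f1\<close> and \<open>g\<close> induce the same
  map \<open>x \<mapsto> x + \<gamma> * Tr x ^ 3\<close>, and it remains to see that this map is an involution.

  It is one because it moves \<open>x\<close> by an element of the small field, whose trace \<open>2 * c\<close> vanishes:
  hence it leaves \<open>Tr x\<close> unchanged, and applying it twice adds \<open>\<gamma> * Tr x ^ 3\<close> twice, that is,
  not at all (lemma \<open>trace_shift_involution\<close>).
\<close>

text \<open>
  Fermat's argument: multiplication by \<open>a \<noteq> 0\<close> permutes the nonzero elements of \<open>K\<close>, so their
  product absorbs the factor \<open>a ^ (card K - 1)\<close>. It serves both for the small field and,
  with \<open>K = UNIV\<close>, for the big one.
\<close>
lemma subfield_power_card: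
  fixes K :: "'a::{field, finite} set"
  assumes K: "is_subfield K" and a: "a \<in> K"
  shows "a ^ card K = a"
proof (cases "a = 0")
  case True
  have "card K \<noteq> 0" using a by auto
  with True show ?thesis by (simp add: power_0_left)
next
  case False
  let ?U = "K - {0}"
  have "(*) a ` ?U = ?U"
  proof (rule card_subset_eq)
    show "(*) a ` ?U \<subseteq> ?U" using K a False by (auto simp: is_subfield_def)
    show "card ((*) a ` ?U) = card ?U" using False by (intro card_image) (auto intro: inj_onI)
  qed simp
  then have "\<Prod>?U = \<Prod>((*) a ` ?U)" by simp
  also have "\<dots> = (\<Prod>x\<in>?U. a * x)"
    using False by (subst prod.reindex) (auto intro: inj_onI)
  also have "\<dots> = a ^ card ?U * \<Prod>?U" by (simp add: prod.distrib)
  finally have "a ^ card ?U = 1" by simp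
  moreover have "card K = Suc (card ?U)"
    using K by (metis card_Suc_Diff1 finite is_subfield_def)
  ultimately show ?thesis by simp
qed

context
  fixes m q :: nat and Fq :: "'a::{field, finite} set"
  assumes m: "m \<ge> 1" and q: "q = 2 ^ m"
    and card_UNIV: "card (UNIV :: 'a set) = q ^ 2"
    and Fq: "is_subfield Fq" and card_Fq: "card Fq = q"
begin

lemma power_q_q: "((x::'a) ^ q) ^ q = x"
  using subfield_power_card[of UNIV x] card_UNIV
  by (simp add: is_subfield_def power2_eq_square power_mult)

text \<open>Since \<open>q\<close> is even, \<open>- 1 = ((- 1) ^ q) ^ q = 1\<close>.\<close>
lemma two_eq_0: "(2::'a) = 0"
proof -
  have "even q" using m q by simp
  then have "(-1::'a) = 1" using power_q_q[of "-1"] by simp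
  then have "(1::'a) + 1 = 0" by (metis add.right_inverse)
  then show ?thesis by simp
qed

lemma double_eq_0: "(x::'a) + x = 0"
  using two_eq_0 by (metis mult_2 mult_zero_left)

lemma power_q_add: "((x::'a) + y) ^ q = x ^ q + y ^ q"
proof (rule freshmans_dream')
  have "CHAR('a) = 2"
  proof (rule CHAR_eqI)
    show "of_nat 2 = (0::'a)" by (simp add: two_eq_0)
    show "2 dvd k" if "of_nat k = (0::'a)" for k
    proof (rule ccontr)
      assume "\<not> 2 dvd k"
      then obtain l where "k = 2 * l + 1" by (rule oddE)
      with that show False by (simp add: two_eq_0)
    qed
  qed
  then show "prime CHAR('a)" and "q = CHAR('a) ^ m" by (simp_all add: q)
qed

lemma rel_trace_add: "rel_trace q ((x::'a) + y) = rel_trace q x + rel_trace q y"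
  by (simp add: rel_trace_def power_q_add)

lemma rel_trace_power_q: "rel_trace q (x::'a) ^ q = rel_trace q x"
  by (simp add: rel_trace_def power_q_add power_q_q add.commute)

lemma rel_trace_cube_plus: "rel_trace q ((x::'a) ^ 3 + x ^ (q + 2)) = rel_trace q x ^ 3"
proof -
  define y where "y = x ^ q"
  have yq: "y ^ q = x" by (simp add: y_def power_q_q)
  have "(x ^ k) ^ q = y ^ k" for k
    by (simp add: y_def power_mult [symmetric] mult.commute)
  then have "rel_trace q (x ^ 3 + x ^ (q + 2)) = x ^ 3 + y * x\<^sup>2 + (y ^ 3 + x * y\<^sup>2)"
    by (simp add: rel_trace_def power_q_add power_add power_mult_distrib yq power2_eq_square
        mult_ac flip: y_def)
  also have "\<dots> = (x + y) ^ 3 - 2 * (y * x\<^sup>2 + x * y\<^sup>2)"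
    by (simp add: power2_eq_square power3_eq_cube algebra_simps)
  finally show ?thesis by (simp add: two_eq_0 rel_trace_def y_def)
qed

lemma trace_shift_involution:
  fixes \<gamma> x :: 'a
  assumes "\<gamma> \<in> Fq"
  defines "h \<equiv> \<lambda>x. x + \<gamma> * rel_trace q x ^ 3"
  shows "h (h x) = x"
proof -
  have "\<gamma> ^ q = \<gamma>" using subfield_power_card[OF Fq assms(1)] card_Fq by simp
  moreover have "(rel_trace q x ^ 3) ^ q = rel_trace q x ^ 3"
    by (metis power_mult mult.commute rel_trace_power_q)
  ultimately have "rel_trace q (\<gamma> * rel_trace q x ^ 3) = 0"
    by (simp add: rel_trace_def[of q "\<gamma> * _"] power_mult_distrib double_eq_0)
  then have "rel_trace q (h x) = rel_trace q x"
    by (simp add: h_def rel_trace_add)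
  then show ?thesis by (simp add: h_def add.assoc double_eq_0)
qed

end

theorem theorem3p1:
  fixes m q :: nat
    and Fq :: "'a::{field, finite} set"
    and \<gamma> :: 'a
    and f1 g :: "'a poly"
  assumes "m \<ge> 1" and "q = 2 ^ m"
    and "card (UNIV :: 'a set) = q ^ 2"
    and "is_subfield Fq" and "card Fq = q"
    and "\<gamma> \<in> Fq"
    and "f1 = monom 1 1 + smult \<gamma> (rel_trace q (monom 1 3 + monom 1 (q + 2)))"
    and "g = monom 1 1 + smult \<gamma> ((rel_trace q (monom 1 1)) ^ 3)"
  shows "permutation_poly f1 \<and> compositional_inverse f1 g"
proof -
  note F = assms(1-5)
  have g: "poly g x = x + \<gamma> * rel_trace q x ^ 3" for x
    by (simp add: assms(8) poly_rel_trace poly_power poly_monom)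
  have f1: "poly f1 x = x + \<gamma> * rel_trace q x ^ 3" for x
    unfolding rel_trace_cube_plus[OF F, symmetric]
    by (simp add: assms(7) poly_rel_trace poly_monom)
  have fg: "poly f1 (poly g x) = x" and gf: "poly g (poly f1 x) = x" for x
    using trace_shift_involution[OF F assms(6)] by (simp_all add: f1 g)
  have "bij (poly f1)"
    by (rule o_bij[of "poly g"]) (auto simp: fg gf)
  with fg gf show ?thesis
    by (simp add: permutation_poly_def compositional_inverse_def)
qed

end
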